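(* Let $$T_{13}=\begin{pmatrix} 1&1&0&0\\ 1&0&1&0\\ 0&1&0&1\\ 0&0&1&1\end{pmatrix}$$ and define the $11\times 11$ matrix $$T=\begin{pmatrix} 0 & 0 & T_{13}\\ 0 & 0 & 0\\ 0 & 0 & 0\end{pmatrix}$$ with respect to the decomposition $\mathbb{R}^{11}=\mathbb{R}^4\oplus\mathbb{R}^3\oplus\mathbb{R}^4$. Then $T$ cannot be written as a commutator $MN-NM$, where $M$ and $N$ are nonnegative $11\times 11$ matrices with $M^2=N^2=0$.
   Context: A matrix is nonnegative if all its entries are (real and) nonnegative. The block form means that the upper-right $4\times 4$ block of $T$ (rows 1-4, columns 8-11) equals $T_{13}$ and all other entries of $T$ are zero. *)

theory Defs
  imports Complex_Main "Jordan_Normal_Form.Matrix"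
begin

definition nonneg_mat :: "real mat \<Rightarrow> bool" where
  "nonneg_mat A \<longleftrightarrow> (\<forall>i < dim_row A. \<forall>j < dim_col A. 0 \<le> A $$ (i, j))"

definition T13 :: "real mat" where
  "T13 = mat_of_rows_list 4
    [[1, 1, 0, 0],
     [1, 0, 1, 0],
     [0, 1, 0, 1],
     [0, 0, 1, 1]]"

(* Matrix indices start at 0, so the blocks of the decomposition 4 + 3 + 4 are
   {0..<4}, {4..<7} and {7..<11}. *)
definition T :: "real mat" where
  "T = mat 11 11 (\<lambda>(i, j). if i < 4 \<and> 7 \<le> j then T13 $$ (i, j - 7) else 0)"

end

(* Nonnegativity and M^2 = N^2 = 0 force MT = TM = NT = TN = 0, so M and N vanish on their first
   four columns and last four rows.  Hence T13 = A D' - A' D with A, A' the 4 x 3 and D, D' the 3 x 4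
   blocks of M, N; and AD = A'D' = 0 means that each of the three middle indices contributes to only
   one of the two products.  So T13 is a signed sum of three products of nonnegative vectors.
   As T13 has rank 3, these vectors lie in its column and row space, whose nonnegative elements
   satisfy v0 + v3 = v1 + v2; pairing with the dual basis then shows that all signs are positive.
   Finally the zero pattern of T13 forces each of the three products to vanish. *)
theory Submission
  imports Defs "Jordan_Normal_Form.Determinant"
begin

section \<open>Signed rank-one decompositions of \<open>T13\<close>\<close>

text \<open>For square matrices a left inverse is a right inverse. This turns a decomposition of the
  identity into biorthogonality of its factors.\<close>

lemma one_sided_inverse_sum:
  fixes P Q :: "nat \<Rightarrow> nat \<Rightarrow> 'a :: field"
  assumes PQ: "\<And>i j. i < n \<Longrightarrow> j < n \<Longrightarrow> (\<Sum>k<n. P i k * Q k j) = (if i = j then 1 else 0)"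
    and ij: "i < n" "j < n"
  shows "(\<Sum>k<n. Q i k * P k j) = (if i = j then 1 else 0)"
proof -
  let ?P = "mat n n (\<lambda>(i, j). P i j)" and ?Q = "mat n n (\<lambda>(i, j). Q i j)"
  have "?P * ?Q = 1\<^sub>m n"
    using PQ by (intro eq_matI) (auto simp: scalar_prod_def atLeast0LessThan)
  then have "?Q * ?P = 1\<^sub>m n"
    using mat_mult_left_right_inverse[of ?P n ?Q] by auto
  then have "(?Q * ?P) $$ (i, j) = 1\<^sub>m n $$ (i, j)" by simp
  then show ?thesis
    using ij by (auto simp: scalar_prod_def atLeast0LessThan)
qed

lemma T13_entries:
  "T13 $$ (0,0) = 1" "T13 $$ (0,1) = 1" "T13 $$ (0,2) = 0" "T13 $$ (0,3) = 0"
  "T13 $$ (1,0) = 1" "T13 $$ (1,1) = 0" "T13 $$ (1,2) = 1" "T13 $$ (1,3) = 0"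
  "T13 $$ (2,0) = 0" "T13 $$ (2,1) = 1" "T13 $$ (2,2) = 0" "T13 $$ (2,3) = 1"
  "T13 $$ (3,0) = 0" "T13 $$ (3,1) = 0" "T13 $$ (3,2) = 1" "T13 $$ (3,3) = 1"
  by (simp_all add: T13_def mat_of_rows_list_def numeral_2_eq_2 numeral_3_eq_3)

lemma less_3_iff: "(k::nat) < 3 \<longleftrightarrow> k = 0 \<or> k = 1 \<or> k = 2"
  by auto

text \<open>The coefficients \<open>y 0 - y 2\<close>, \<open>y 2\<close>,
  \<open>y 1 + y 2 - y 0\<close> are the coordinates of \<open>y\<close> in the first three rows of
  \<open>T13\<close>. The sum of the first and last rows equals that of the middle two, so a
  nonnegative \<open>y\<close> is a nonnegative combination of rows 0, 1, 2 or of rows 1, 2, 3; the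
  case split chooses between them.\<close>

lemma dual_pairing_nonneg:
  fixes x y :: "nat \<Rightarrow> real"
  assumes x: "\<And>i. i < 4 \<Longrightarrow> 0 \<le> x i" "x 0 + x 3 = x 1 + x 2"
    and y: "\<And>i. i < 4 \<Longrightarrow> 0 \<le> y i" "y 0 + y 3 = y 1 + y 2"
  shows "0 \<le> (y 0 - y 2) * x 0 + y 2 * x 1 + (y 1 + y 2 - y 0) * x 2"
proof -
  have nn: "0 \<le> x 0" "0 \<le> x 1" "0 \<le> x 2" "0 \<le> x 3" "0 \<le> y 0" "0 \<le> y 1" "0 \<le> y 2" "0 \<le> y 3"
    using x(1) y(1) by simp_all
  have y3: "y 3 = y 1 + y 2 - y 0" using y(2) by simp
  show ?thesis
  proof (cases "y 2 \<le> y 0")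
    case True
    then have "0 \<le> (y 0 - y 2) * x 0" "0 \<le> y 2 * x 1" "0 \<le> y 3 * x 2"
      using nn by simp_all
    then show ?thesis unfolding y3 by linarith
  next
    case False
    then have "0 \<le> (y 2 - y 0) * x 3" "0 \<le> y 0 * x 1" "0 \<le> y 1 * x 2"
      using nn by simp_all
    moreover have "(y 0 - y 2) * x 0 + y 2 * x 1 + (y 1 + y 2 - y 0) * x 2
        = (y 2 - y 0) * (x 1 + x 2 - x 0) + y 0 * x 1 + y 1 * x 2"
      by (simp add: algebra_simps)
    moreover have "x 3 = x 1 + x 2 - x 0" using x(2) by simp
    ultimately show ?thesis by (simp only:) 
  qed
qed

text \<open>If \<open>x 0\<close> and \<open>y 0\<close> were nonzero, the zeros in row 0 would give
  \<open>y 2 = y 3 = 0\<close>, hence \<open>y 1 = y 0\<close>. The zeros at (1,1) and (2,0) would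
  then give \<open>x 1 = x 2 = 0\<close>, so \<open>x 0 + x 3 = 0\<close> and
  \<open>x 0 = 0\<close>.\<close>

lemma T13_zero_pattern_product:
  fixes x y :: "nat \<Rightarrow> real"
  assumes x: "\<And>i. i < 4 \<Longrightarrow> 0 \<le> x i" "x 0 + x 3 = x 1 + x 2"
    and y: "y 0 + y 3 = y 1 + y 2"
    and z: "\<And>i j. i < 4 \<Longrightarrow> j < 4 \<Longrightarrow> T13 $$ (i, j) = 0 \<Longrightarrow> x i * y j = 0"
  shows "x 0 * y 0 = 0"
proof -
  have "0 \<le> x 0" "0 \<le> x 1" "0 \<le> x 2" "0 \<le> x 3"
    using x(1) by simp_all
  moreover have "x 0 * y 2 = 0" "x 0 * y 3 = 0" "x 1 * y 1 = 0" "x 2 * y 0 = 0"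
    using z T13_entries by simp_all
  ultimately show ?thesis
    using x(2) y by (smt (verit) mult_eq_0_iff)
qed

lemma T13_not_signed_sum_of_three:
  fixes x y :: "nat \<Rightarrow> nat \<Rightarrow> real" and e :: "nat \<Rightarrow> real"
  assumes x: "\<And>k i. k < 3 \<Longrightarrow> i < 4 \<Longrightarrow> 0 \<le> x k i"
    and y: "\<And>k j. k < 3 \<Longrightarrow> j < 4 \<Longrightarrow> 0 \<le> y k j"
    and e: "\<And>k. k < 3 \<Longrightarrow> e k = 1 \<or> e k = - 1"
    and T: "\<And>i j. i < 4 \<Longrightarrow> j < 4 \<Longrightarrow> T13 $$ (i, j) = (\<Sum>k<3. e k * x k i * y k j)"
  shows False
proof -
  have sum3: "(\<Sum>k<3. g k) = g 0 + g 1 + g 2" for g :: "nat \<Rightarrow> real"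
    by (simp add: numeral_3_eq_3 numeral_2_eq_2)
  have E: "T13 $$ (i, j) = e 0 * x 0 i * y 0 j + e 1 * x 1 i * y 1 j + e 2 * x 2 i * y 2 j"
    if "i < 4" "j < 4" for i j
    using T[OF that] by (simp add: sum3)
  \<comment> \<open>The leading 3 x 3 minor of \<open>T13\<close> is invertible; \<open>q\<close> is the matrix with rows \<open>e k * y k\<close>,
    restricted to the first three columns and multiplied by the inverse of that minor.\<close>
  define q where "q k i = e k * (if i = 0 then y k 0 - y k 2 else if i = 1 then y k 2
    else y k 1 + y k 2 - y k 0)" for k i :: nat
  \<comment> \<open>For \<open>i < 3\<close> the three right-hand sides are the unit vectors, so the
    \<open>q k\<close> will be dual to the \<open>x k\<close>.\<close>
  have xq: "(\<Sum>k<3. x k i * q k 0) = T13 $$ (i, 0) - T13 $$ (i, 2)"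
    "(\<Sum>k<3. x k i * q k 1) = T13 $$ (i, 2)"
    "(\<Sum>k<3. x k i * q k 2) = T13 $$ (i, 1) + T13 $$ (i, 2) - T13 $$ (i, 0)" if "i < 4" for i
    using that unfolding sum3 q_def by (simp_all add: E algebra_simps)
  have "(\<Sum>k<3. x k i * q k j) = (if i = j then 1 else 0)" if "i < 3" "j < 3" for i j
    using that unfolding less_3_iff by (elim disjE) (simp_all only: xq, simp_all add: T13_entries[simplified] xq[simplified])
  then have dual: "(\<Sum>i<3. q k i * x l i) = (if k = l then 1 else 0)" if "k < 3" "l < 3" for k l
    using one_sided_inverse_sum[of 3 "\<lambda>i k. x k i" q k l] that by simp
  have x_lin: "x l 0 + x l 3 = x l 1 + x l 2" if l: "l < 3" for l
  proof -
    \<comment> \<open>The defect of the wanted relation. Rows 0 and 3 of \<open>T13\<close> have the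
      same sum as rows 1 and 2, so \<open>c\<close> is orthogonal to the columns of
      \<open>q\<close>; duality then recovers \<open>c l = 0\<close>.\<close>
    define c where "c k = x k 0 + x k 3 - x k 1 - x k 2" for k
    have "(\<Sum>k<3. c k * q k i) = (\<Sum>k<3. x k 0 * q k i) + (\<Sum>k<3. x k 3 * q k i)
        - (\<Sum>k<3. x k 1 * q k i) - (\<Sum>k<3. x k 2 * q k i)" for i
      by (simp add: c_def algebra_simps sum.distrib sum_subtractf)
    then have c0: "(\<Sum>k<3. c k * q k i) = 0" if "i < 3" for i
      using that xq[of 0] xq[of 1] xq[of 2] xq[of 3] unfolding less_3_iff
      by (elim disjE) (simp_all add: T13_entries[simplified])
    have "c l = (\<Sum>k<3. c k * (if k = l then 1 else 0))"
      using l unfolding less_3_iff sum3 by auto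
    also have "\<dots> = (\<Sum>k<3. \<Sum>i<3. c k * q k i * x l i)"
      using l by (intro sum.cong) (auto simp: sum_distrib_left mult.assoc simp flip: dual)
    also have "\<dots> = (\<Sum>i<3. (\<Sum>k<3. c k * q k i) * x l i)"
      by (subst sum.swap) (simp add: sum_distrib_right)
    also have "\<dots> = 0" using c0 by simp
    finally show ?thesis by (simp add: c_def)
  qed
  have y_lin: "y l 0 + y l 3 = y l 1 + y l 2" if l: "l < 3" for l
  proof -
    \<comment> \<open>The same argument for the column relation of \<open>T13\<close>; the sign
      \<open>e k\<close> is nonzero and can be cancelled at the end.\<close>
    define c where "c k = e k * (y k 0 + y k 3 - y k 1 - y k 2)" for k
    have "(\<Sum>k<3. x k i * c k) = T13 $$ (i, 0) + T13 $$ (i, 3) - T13 $$ (i, 1) - T13 $$ (i, 2)"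
      if "i < 4" for i
      using that unfolding sum3 c_def by (simp add: E algebra_simps)
    then have c0: "(\<Sum>k<3. x k i * c k) = 0" if "i < 3" for i
      using that unfolding less_3_iff by (elim disjE) (simp_all add: T13_entries[simplified])
    have "c l = (\<Sum>k<3. (if l = k then 1 else 0) * c k)"
      using l unfolding less_3_iff sum3 by auto
    also have "\<dots> = (\<Sum>k<3. \<Sum>i<3. q l i * (x k i * c k))"
      using l by (intro sum.cong) (auto simp: sum_distrib_right mult.assoc simp flip: dual)
    also have "\<dots> = (\<Sum>i<3. q l i * (\<Sum>k<3. x k i * c k))"
      by (subst sum.swap) (simp add: sum_distrib_left)
    also have "\<dots> = 0" using c0 by simp
    finally show ?thesis using e[OF l] by (auto simp: c_def)
  qed
  \<comment> \<open>The diagonal duality relation says that \<open>e k\<close> times a nonnegative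
    pairing is 1.\<close>
  have e1: "e k = 1" if k: "k < 3" for k
  proof (rule ccontr)
    assume "e k \<noteq> 1"
    then have "e k = - 1" using e[OF k] by simp
    moreover have "e k * ((y k 0 - y k 2) * x k 0 + y k 2 * x k 1
        + (y k 1 + y k 2 - y k 0) * x k 2) = 1"
      using dual[OF k k] by (simp add: sum3 q_def algebra_simps)
    moreover have "0 \<le> (y k 0 - y k 2) * x k 0 + y k 2 * x k 1 + (y k 1 + y k 2 - y k 0) * x k 2"
      using x y x_lin y_lin k by (intro dual_pairing_nonneg) auto
    ultimately show False by simp
  qed
  have diag: "x k 0 * y k 0 = 0" if k: "k < 3" for k
  proof (rule T13_zero_pattern_product)
    fix i j :: nat
    assume ij: "i < 4" "j < 4" and z: "T13 $$ (i, j) = 0"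
    \<comment> \<open>With all signs positive no cancellation is possible, so a zero entry of
      \<open>T13\<close> kills each summand.\<close>
    have "(\<Sum>k<3. x k i * y k j) = 0"
      using T[OF ij] z e1 by simp
    then show "x k i * y k j = 0"
      using x y ij k by (subst (asm) sum_nonneg_eq_0_iff) auto
  qed (use x x_lin y_lin k in auto)
  have "T13 $$ (0, 0) = 0"
    unfolding T[of 0 0, simplified] using diag e1 by (intro sum.neutral) simp
  then show False by (simp add: T13_entries)
qed

section \<open>Products of nonnegative matrices and square-zero commutators\<close>

lemma nonneg_mat_mult:
  assumes "nonneg_mat A" "nonneg_mat B" "dim_col A = dim_row B"
  shows "nonneg_mat (A * B)"
  using assms by (auto simp: nonneg_mat_def scalar_prod_def intro!: sum_nonneg)

lemma mult_entry:
  assumes "A \<in> carrier_mat n m" "B \<in> carrier_mat m p" "i < n" "j < p"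
  shows "(A * B) $$ (i, j) = (\<Sum>l<m. A $$ (i, l) * B $$ (l, j))"
  using assms by (auto simp: scalar_prod_def atLeast0LessThan)

text \<open>A vanishing sum of nonnegative terms vanishes term by term.\<close>

lemma nonneg_mult_zero_entry:
  assumes "A \<in> carrier_mat n m" "B \<in> carrier_mat m p" "nonneg_mat A" "nonneg_mat B"
    and "A * B = 0\<^sub>m n p" "i < n" "l < m" "j < p"
  shows "A $$ (i, l) * B $$ (l, j) = 0"
proof -
  have "(\<Sum>l<m. A $$ (i, l) * B $$ (l, j)) = 0"
    using mult_entry[OF assms(1,2) \<open>i < n\<close> \<open>j < p\<close>] assms by simp
  then show ?thesis
    using assms by (subst (asm) sum_nonneg_eq_0_iff) (auto simp: nonneg_mat_def)
qed

lemma nonneg_eq_uminus_nonneg: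
  assumes "A \<in> carrier_mat n m" "B \<in> carrier_mat n m" "nonneg_mat A" "nonneg_mat B" "A = - B"
  shows "A = 0\<^sub>m n m" "B = 0\<^sub>m n m"
proof -
  have "A $$ (i, j) = 0 \<and> B $$ (i, j) = 0" if "i < n" "j < m" for i j
  proof -
    have "A $$ (i, j) = - B $$ (i, j)" using assms that by auto
    moreover have "0 \<le> A $$ (i, j)" "0 \<le> B $$ (i, j)"
      using assms that unfolding nonneg_mat_def by auto
    ultimately show ?thesis by simp
  qed
  then show "A = 0\<^sub>m n m" "B = 0\<^sub>m n m" using assms(1,2) by (auto intro!: eq_matI)
qed

text \<open>The zero squares leave \<open>M * S = - (M * N * M)\<close> and
  \<open>S * M = M * N * M\<close>. As \<open>M * S\<close> and \<open>M * N * M\<close> are both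
  nonnegative, both are zero; likewise for \<open>N\<close>.\<close>

lemma nonneg_square_zero_commutator:
  assumes M: "M \<in> carrier_mat n n" and N: "N \<in> carrier_mat n n"
    and nn: "nonneg_mat M" "nonneg_mat N" "nonneg_mat S"
    and sq: "M * M = 0\<^sub>m n n" "N * N = 0\<^sub>m n n" and S: "S = M * N - N * M"
  shows "M * S = 0\<^sub>m n n" "S * M = 0\<^sub>m n n" "N * S = 0\<^sub>m n n" "S * N = 0\<^sub>m n n"
proof -
  have MN: "M * N \<in> carrier_mat n n" and NM: "N * M \<in> carrier_mat n n" using M N by auto
  have Sc: "S \<in> carrier_mat n n" unfolding S using NM MN by (intro minus_carrier_mat)
  have MNMc: "M * N * M \<in> carrier_mat n n" and NMNc: "N * M * N \<in> carrier_mat n n"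
    using M N by auto
  have minus: "0\<^sub>m n n - A = - A" "A - 0\<^sub>m n n = A" if "A \<in> carrier_mat n n" for A :: "real mat"
    using that by auto
  have MS: "M * S = - (M * N * M)"
  proof -
    have "M * S = M * (M * N) - M * (N * M)"
      unfolding S using mult_minus_distrib_mat[OF M MN NM] .
    also have "M * (M * N) = 0\<^sub>m n n"
      using assoc_mult_mat[OF M M N] sq N by simp
    also have "M * (N * M) = M * N * M" using assoc_mult_mat[OF M N M] by simp
    finally show ?thesis by (simp only: minus[OF MNMc])
  qed
  have SM: "S * M = M * N * M"
  proof -
    have "S * M = M * N * M - N * M * M"
      unfolding S using minus_mult_distrib_mat[OF MN NM M] .
    also have "N * M * M = 0\<^sub>m n n" using assoc_mult_mat[OF N M M] sq N by simp
    finally show ?thesis by (simp only: minus[OF MNMc])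
  qed
  have NS: "N * S = N * M * N"
  proof -
    have "N * S = N * (M * N) - N * (N * M)"
      unfolding S using mult_minus_distrib_mat[OF N MN NM] .
    also have "N * (N * M) = 0\<^sub>m n n"
      using assoc_mult_mat[OF N N M] sq M by simp
    also have "N * (M * N) = N * M * N" using assoc_mult_mat[OF N M N] by simp
    finally show ?thesis by (simp only: minus[OF NMNc])
  qed
  have SN: "S * N = - (N * M * N)"
  proof -
    have "S * N = M * N * N - N * M * N"
      unfolding S using minus_mult_distrib_mat[OF MN NM N] .
    also have "M * N * N = 0\<^sub>m n n" using assoc_mult_mat[OF M N N] sq M by simp
    finally show ?thesis by (simp only: minus[OF NMNc])
  qed
  have "nonneg_mat (M * N * M)" "nonneg_mat (N * M * N)" "nonneg_mat (M * S)" "nonneg_mat (S * N)"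
    using nn M N Sc by (auto intro!: nonneg_mat_mult)
  then show "M * S = 0\<^sub>m n n" "S * M = 0\<^sub>m n n" "N * S = 0\<^sub>m n n" "S * N = 0\<^sub>m n n"
    using nonneg_eq_uminus_nonneg[OF _ MNMc _ _ MS] nonneg_eq_uminus_nonneg[OF _ NMNc _ _ SN]
      M N Sc SM NS by auto
qed

section \<open>Reduction of the commutator equation to \<open>T13\<close>\<close>

lemma less_4_iff: "(k::nat) < 4 \<longleftrightarrow> k = 0 \<or> k = 1 \<or> k = 2 \<or> k = 3"
  by auto

lemma nonneg_T: "nonneg_mat T"
proof -
  have "0 \<le> T13 $$ (i, j)" if "i < 4" "j < 4" for i j
    using that T13_entries unfolding less_4_iff by (elim disjE) simp_all
  then show ?thesis by (auto simp: nonneg_mat_def T_def)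
qed

lemma T_row_nonzero:
  assumes "i < 4" shows "\<exists>j<11. T $$ (i, j) \<noteq> 0"
proof -
  have "\<exists>j<4. T13 $$ (i, j) \<noteq> 0"
    using assms T13_entries unfolding less_4_iff
    by (elim disjE) (metis zero_neq_one)+
  then obtain j where "j < 4" "T13 $$ (i, j) \<noteq> 0" by blast
  then show ?thesis using assms by (intro exI[of _ "j + 7"]) (simp add: T_def)
qed

lemma T_col_nonzero:
  assumes "7 \<le> j" "j < 11" shows "\<exists>i<11. T $$ (i, j) \<noteq> 0"
proof -
  have "j - 7 < 4" using assms by auto
  then have "\<exists>i<4. T13 $$ (i, j - 7) \<noteq> 0"
    using T13_entries unfolding less_4_iff by (elim disjE) (metis zero_neq_one)+
  then obtain i where "i < 4" "T13 $$ (i, j - 7) \<noteq> 0" by blast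
  then show ?thesis using assms by (intro exI[of _ i]) (simp add: T_def)
qed

theorem theorem2p4:
  shows "\<not> (\<exists>M N :: real mat.
    M \<in> carrier_mat 11 11 \<and> N \<in> carrier_mat 11 11 \<and>
    nonneg_mat M \<and> nonneg_mat N \<and>
    M ^\<^sub>m 2 = 0\<^sub>m 11 11 \<and> N ^\<^sub>m 2 = 0\<^sub>m 11 11 \<and>
    T = M * N - N * M)"
proof
  assume "\<exists>M N :: real mat.
    M \<in> carrier_mat 11 11 \<and> N \<in> carrier_mat 11 11 \<and>
    nonneg_mat M \<and> nonneg_mat N \<and>
    M ^\<^sub>m 2 = 0\<^sub>m 11 11 \<and> N ^\<^sub>m 2 = 0\<^sub>m 11 11 \<and>
    T = M * N - N * M"
  then obtain M N :: "real mat" where M: "M \<in> carrier_mat 11 11" and N: "N \<in> carrier_mat 11 11"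
    and nn: "nonneg_mat M" "nonneg_mat N"
    and sq': "M ^\<^sub>m 2 = 0\<^sub>m 11 11" "N ^\<^sub>m 2 = 0\<^sub>m 11 11" and T: "T = M * N - N * M"
    by blast
  have sq: "M * M = 0\<^sub>m 11 11" "N * N = 0\<^sub>m 11 11"
    using sq' M N by (simp_all add: numeral_2_eq_2)
  have Tc: "T \<in> carrier_mat 11 11" by (simp add: T_def)
  note ann = nonneg_square_zero_commutator[OF M N nn nonneg_T sq T]
  \<comment> \<open>A nonzero entry in row \<open>l\<close> of \<open>T\<close> makes
    \<open>A * T = 0\<close> annihilate column \<open>l\<close> of \<open>A\<close>;
    \<open>rows\<close> is the mirror image.\<close>
  have cols: "A $$ (i, l) = 0"
    if "A \<in> carrier_mat 11 11" "nonneg_mat A" "A * T = 0\<^sub>m 11 11" "i < 11" "l < 4" for A i l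
  proof -
    obtain j where j: "j < 11" "T $$ (l, j) \<noteq> 0"
      using T_row_nonzero[OF \<open>l < 4\<close>] by blast
    have "l < 11" using \<open>l < 4\<close> by simp
    from nonneg_mult_zero_entry[OF that(1) Tc that(2) nonneg_T that(3,4) this j(1)] j(2)
    show ?thesis by simp
  qed
  have rows: "A $$ (l, j) = 0"
    if "A \<in> carrier_mat 11 11" "nonneg_mat A" "T * A = 0\<^sub>m 11 11" "7 \<le> l" "l < 11" "j < 11"
    for A j l
  proof -
    obtain i where i: "i < 11" "T $$ (i, l) \<noteq> 0"
      using T_col_nonzero[OF \<open>7 \<le> l\<close> \<open>l < 11\<close>] by blast
    from nonneg_mult_zero_entry[OF Tc that(1) nonneg_T that(2,3) i(1) that(5,6)] i(2)
    show ?thesis by simp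
  qed
  have nonneg: "0 \<le> M $$ (i, j)" "0 \<le> N $$ (i, j)" if "i < 11" "j < 11" for i j
    using nn M N that by (auto simp: nonneg_mat_def)
  \<comment> \<open>\<open>R\<close> expresses the contribution of the middle index
    \<open>k + 4\<close> as one signed product. The shifts 4 and 7 lead into the middle and the last
    block.\<close>
  define R where "R k x y e \<longleftrightarrow> (\<forall>i<4. 0 \<le> x i) \<and> (\<forall>j<4. 0 \<le> y j) \<and> (e = 1 \<or> e = - 1) \<and>
      (\<forall>i<4. \<forall>j<4. M $$ (i, k + 4) * N $$ (k + 4, j + 7) - N $$ (i, k + 4) * M $$ (k + 4, j + 7)
        = e * x i * y j)" for k x y and e :: real
  have "\<exists>x y e. R k x y e" if k: "k < 3" for k
  proof (cases "\<exists>i<4. \<exists>j<4. M $$ (i, k + 4) * N $$ (k + 4, j + 7) \<noteq> 0")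
    case True
    then obtain i0 j0 where ij0: "i0 < 4" "j0 < 4"
      and ne: "M $$ (i0, k + 4) \<noteq> 0" "N $$ (k + 4, j0 + 7) \<noteq> 0" by auto
    \<comment> \<open>The nonzero entry of \<open>N\<close> in row \<open>k + 4\<close> and
      \<open>N * N = 0\<close> empty column \<open>k + 4\<close> of \<open>N\<close>, so only the
      positive product remains.\<close>
    have "N $$ (i, k + 4) = 0" if "i < 4" for i
      using nonneg_mult_zero_entry[OF N N nn(2,2) sq(2), of i "k + 4" "j0 + 7"] ne ij0 k that by simp
    then have "R k (\<lambda>i. M $$ (i, k + 4)) (\<lambda>j. N $$ (k + 4, j + 7)) 1"
      using nonneg k by (simp add: R_def)
    then show ?thesis by (intro exI)
  next
    case False
    then have "R k (\<lambda>i. N $$ (i, k + 4)) (\<lambda>j. M $$ (k + 4, j + 7)) (- 1)"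
      using nonneg k by (simp add: R_def)
    then show ?thesis by (intro exI)
  qed
  then obtain x y e where "\<And>k. k < 3 \<Longrightarrow> R k (x k) (y k) (e k)"
    by metis
  note xye = this[unfolded R_def]
  have "T13 $$ (i, j) = (\<Sum>k<3. e k * x k i * y k j)" if ij: "i < 4" "j < 4" for i j
  proof -
    let ?g = "\<lambda>l. M $$ (i, l) * N $$ (l, j + 7) - N $$ (i, l) * M $$ (l, j + 7)"
    have "T13 $$ (i, j) = T $$ (i, j + 7)" using ij by (simp add: T_def)
    also have "\<dots> = (M * N) $$ (i, j + 7) - (N * M) $$ (i, j + 7)"
      unfolding T using M N ij by simp
    also have "\<dots> = (\<Sum>l<11. ?g l)"
      using ij by (simp add: mult_entry[OF M N] mult_entry[OF N M] sum_subtractf)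
    \<comment> \<open>For \<open>l < 4\<close> the left factors vanish by \<open>cols\<close>; for
      \<open>7 \<le> l\<close> the right factors vanish by \<open>rows\<close>.\<close>
    also have "\<dots> = (\<Sum>l\<in>{4..<7}. ?g l)"
    proof (rule sum.mono_neutral_right)
      show "\<forall>l\<in>{..<11} - {4..<7}. ?g l = 0"
      proof
        fix l :: nat
        assume "l \<in> {..<11} - {4..<7}"
        then have "l < 4 \<or> 7 \<le> l" "l < 11" by auto
        then show "?g l = 0"
          using cols[OF M nn(1) ann(1)] cols[OF N nn(2) ann(3)]
            rows[OF M nn(1) ann(2)] rows[OF N nn(2) ann(4)] ij by auto
      qed
    qed auto
    also have "\<dots> = (\<Sum>k<3. ?g (k + 4))"
      using sum.shift_bounds_nat_ivl[of ?g 0 4 3] by (simp add: atLeast0LessThan)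
    also have "\<dots> = (\<Sum>k<3. e k * x k i * y k j)"
      using xye ij by (intro sum.cong) auto
    finally show ?thesis .
  qed
  then show False
    using T13_not_signed_sum_of_three[of x y e] xye by blast
qed

end
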